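(* Let $d\in\mathbb{N}$ and let $X\in(\mathbb{M}_d\otimes\mathbb{M}_d)^+$ be separable. Then $$\lambda X+\lambda(\mathsf{T}\otimes\mathrm{id}_d)X+(I_d\otimes\mathrm{tr}_1(X))\geq 0,$$ $$\lambda X+\lambda(\mathrm{id}_d\otimes\mathsf{T})X+(\mathrm{tr}_2(X)\otimes I_d)\geq 0$$ for all $\lambda\in[-\tfrac12,\infty)$.
   Context: $\mathbb{M}_d$ is the algebra of complex $d\times d$ matrices; a superscript $+$ denotes the cone of positive semidefinite matrices and $A\ge0$ means $A$ is positive semidefinite. $X\in(\mathbb{M}_d\otimes\mathbb{M}_d)^+$ is separable if $X=\sum_i A_i\otimes B_i$ (finite sum) with $A_i,B_i\in\mathbb{M}_d^+$. $\mathsf{T}$ is the transpose map on $\mathbb{M}_d$, $\mathrm{id}_d$ the identity map, $I_d$ the identity matrix. The partial traces are the linear maps with $\mathrm{tr}_1(A\otimes B)=\mathrm{tr}(A)B$ and $\mathrm{tr}_2(A\otimes B)=\mathrm{tr}(B)A$. *)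

theory Defs
  imports "HOL-Analysis.Analysis"
begin

definition cscale :: "complex \<Rightarrow> complex^'n^'m \<Rightarrow> complex^'n^'m" where
  "cscale c A = (\<chi> i j. c * A $ i $ j)"

definition hermitian :: "complex^'n^'n \<Rightarrow> bool" where
  "hermitian A \<longleftrightarrow> (\<forall>i j. A $ i $ j = cnj (A $ j $ i))"

text \<open>For Hermitian \<open>A\<close> the quadratic form is real-valued, so \<open>Re\<close> discards nothing.\<close>

definition psd :: "complex^'n^'n \<Rightarrow> bool" where
  "psd A \<longleftrightarrow> hermitian A \<and>
     (\<forall>v :: complex^'n. 0 \<le> Re (\<Sum>i\<in>UNIV. cnj (v $ i) * (A *v v) $ i))"

text \<open>The algebra \<open>M\<^sub>d \<otimes> M\<^sub>d\<close> is realised as the matrices indexed by pairs, with \<open>A \<otimes> B\<close> being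
  the Kronecker product; the first component of an index belongs to the first tensor factor.\<close>

definition kron :: "complex^'a^'a \<Rightarrow> complex^'b^'b \<Rightarrow> complex^('a \<times> 'b)^('a \<times> 'b)" where
  "kron A B = (\<chi> p q. A $ fst p $ fst q * B $ snd p $ snd q)"

definition separable :: "complex^('d::finite \<times> 'd)^('d \<times> 'd) \<Rightarrow> bool" where
  "separable X \<longleftrightarrow>
     (\<exists>(n::nat) (A :: nat \<Rightarrow> complex^'d^'d) (B :: nat \<Rightarrow> complex^'d^'d).
        (\<forall>i<n. psd (A i) \<and> psd (B i)) \<and> X = (\<Sum>i<n. kron (A i) (B i)))"

definition matrix_unit :: "'n \<Rightarrow> 'n \<Rightarrow> complex^'n^'n" where
  "matrix_unit i j = (\<chi> k l. if k = i \<and> l = j then 1 else 0)"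

text \<open>The tensor product of two linear maps, given on the basis of tensor products of matrix
  units. It is meaningful for complex-linear maps only; lemma \<open>tensor_map_kron\<close> is its
  defining property.\<close>

definition tensor_map ::
  "(complex^'a^'a \<Rightarrow> complex^'c^'c) \<Rightarrow> (complex^'b^'b \<Rightarrow> complex^'e^'e)
    \<Rightarrow> complex^('a::finite \<times> 'b::finite)^('a \<times> 'b) \<Rightarrow> complex^('c::finite \<times> 'e::finite)^('c \<times> 'e)"
  where
  "tensor_map \<Phi> \<Psi> X = (\<Sum>i\<in>UNIV. \<Sum>j\<in>UNIV. \<Sum>k\<in>UNIV. \<Sum>l\<in>UNIV.
      cscale (X $ (i, k) $ (j, l)) (kron (\<Phi> (matrix_unit i j)) (\<Psi> (matrix_unit k l))))"

definition tr1 :: "complex^('a::finite \<times> 'b::finite)^('a \<times> 'b) \<Rightarrow> complex^'b^'b" where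
  "tr1 X = (\<chi> k l. \<Sum>i\<in>UNIV. X $ (i, k) $ (i, l))"

definition tr2 :: "complex^('a::finite \<times> 'b::finite)^('a \<times> 'b) \<Rightarrow> complex^'a^'a" where
  "tr2 X = (\<chi> i j. \<Sum>k\<in>UNIV. X $ (i, k) $ (j, k))"

lemma vector_space_cscale: "vector_space (cscale :: complex \<Rightarrow> complex^'n^'m \<Rightarrow> _)"
  by unfold_locales (simp_all add: cscale_def vec_eq_iff algebra_simps)

lemma linear_cscale_iff:
  "Vector_Spaces.linear cscale cscale f \<longleftrightarrow>
     (\<forall>A B. f (A + B) = f A + f B) \<and> (\<forall>c A. f (cscale c A) = cscale c (f A))"
  by (simp add: Vector_Spaces.linear_def vector_space_cscale module_hom_def
      vector_space_cscale[unfolded module_iff_vector_space[symmetric]] module_hom_axioms_def)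

lemma linear_tr1: "Vector_Spaces.linear cscale cscale tr1"
  by (simp add: linear_cscale_iff tr1_def cscale_def vec_eq_iff sum.distrib sum_distrib_left)

lemma linear_tr2: "Vector_Spaces.linear cscale cscale tr2"
  by (simp add: linear_cscale_iff tr2_def cscale_def vec_eq_iff sum.distrib sum_distrib_left)

lemma tr1_kron: "tr1 (kron A B) = cscale (trace A) B"
  by (simp add: tr1_def kron_def cscale_def trace_def vec_eq_iff sum_distrib_right)

lemma tr2_kron: "tr2 (kron A B) = cscale (trace B) A"
  by (simp add: tr2_def kron_def cscale_def trace_def vec_eq_iff sum_distrib_right
      sum_distrib_left mult.commute)

lemma linear_tensor_map: "Vector_Spaces.linear cscale cscale (tensor_map \<Phi> \<Psi>)"
  by (simp add: linear_cscale_iff tensor_map_def cscale_def vec_eq_iff sum.distrib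
      sum_distrib_left algebra_simps)

lemma linear_transpose: "Vector_Spaces.linear cscale cscale (transpose :: complex^'n^'n \<Rightarrow> _)"
  by (simp add: linear_cscale_iff transpose_def cscale_def vec_eq_iff)

lemma linear_ident: "Vector_Spaces.linear cscale cscale (id :: complex^'n^'n \<Rightarrow> _)"
  by (simp add: linear_cscale_iff)

lemma linear_expand:
  fixes f :: "complex^'n^'n \<Rightarrow> complex^'m^'m"
  assumes f: "Vector_Spaces.linear cscale cscale f"
  shows "f A $ r $ s = (\<Sum>i\<in>UNIV. \<Sum>j\<in>UNIV. A $ i $ j * f (matrix_unit i j) $ r $ s)"
proof -
  have add: "f (A + B) = f A + f B" and scl: "f (cscale c A) = cscale c (f A)" for A B c
    using f by (auto simp: linear_cscale_iff)
  have "f 0 = 0" using add[of 0 0] by simp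
  then have fsum: "f (\<Sum>i\<in>S. g i) = (\<Sum>i\<in>S. f (g i))" for g and S :: "'n set"
    by (induction S rule: infinite_finite_induct) (simp_all add: add)
  have "A = (\<Sum>i\<in>UNIV. \<Sum>j\<in>UNIV. cscale (A $ i $ j) (matrix_unit i j))"
  proof -
    have "(\<Sum>i\<in>UNIV. \<Sum>j\<in>UNIV. A $ i $ j * (if k = i \<and> l = j then 1 else 0)) = A $ k $ l" for k l
    proof -
      have "(\<Sum>i\<in>UNIV. \<Sum>j\<in>UNIV. A $ i $ j * (if k = i \<and> l = j then 1 else 0))
          = (\<Sum>i\<in>UNIV. if k = i then \<Sum>j\<in>UNIV. if l = j then A $ i $ j else 0 else 0)"
        by (intro sum.cong refl) (auto simp: if_distrib cong: if_cong)
      also have "\<dots> = A $ k $ l" by simp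
      finally show ?thesis .
    qed
    then show ?thesis
      by (simp add: vec_eq_iff cscale_def matrix_unit_def)
  qed
  then have "f A = (\<Sum>i\<in>UNIV. \<Sum>j\<in>UNIV. cscale (A $ i $ j) (f (matrix_unit i j)))"
    by (metis (no_types, lifting) fsum scl sum.cong)
  then show ?thesis by (simp add: cscale_def)
qed

lemma tensor_map_kron:
  assumes "Vector_Spaces.linear cscale cscale \<Phi>" "Vector_Spaces.linear cscale cscale \<Psi>"
  shows "tensor_map \<Phi> \<Psi> (kron A B) = kron (\<Phi> A) (\<Psi> B)"
proof -
  have "tensor_map \<Phi> \<Psi> (kron A B) $ p $ q = kron (\<Phi> A) (\<Psi> B) $ p $ q" for p q
  proof -
    have "kron (\<Phi> A) (\<Psi> B) $ p $ q
        = (\<Sum>i\<in>UNIV. \<Sum>j\<in>UNIV. A $ i $ j * \<Phi> (matrix_unit i j) $ fst p $ fst q)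
        * (\<Sum>k\<in>UNIV. \<Sum>l\<in>UNIV. B $ k $ l * \<Psi> (matrix_unit k l) $ snd p $ snd q)"
      by (simp add: kron_def linear_expand[OF assms(1), of A] linear_expand[OF assms(2), of B])
    also have "\<dots> = (\<Sum>i\<in>UNIV. \<Sum>j\<in>UNIV. \<Sum>k\<in>UNIV. \<Sum>l\<in>UNIV.
        (A $ i $ j * \<Phi> (matrix_unit i j) $ fst p $ fst q)
        * (B $ k $ l * \<Psi> (matrix_unit k l) $ snd p $ snd q))"
      by (simp only: sum_distrib_right) (simp only: sum_distrib_left)
    also have "\<dots> = tensor_map \<Phi> \<Psi> (kron A B) $ p $ q"
      by (simp add: tensor_map_def cscale_def kron_def mult_ac)
    finally show ?thesis by simp
  qed
  then show ?thesis by (simp add: vec_eq_iff)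
qed

end

theory Submission
  imports Defs
begin

text \<open>
  The left-hand sides are linear in \<open>X\<close>, so a product \<open>X = A \<otimes> B\<close> with \<open>A, B \<ge> 0\<close> is enough. There
  the first expression is \<open>(c A + c A\<^sup>T + tr(A) I) \<otimes> B\<close>, the second one is
  \<open>A \<otimes> (c B + c B\<^sup>T + tr(B) I)\<close>, and two facts remain.

  The inequality for one factor rests on \<open>A \<le> tr(A) I\<close> (lemma \<open>psd_trace_bound\<close>). This bound also
  holds for \<open>A\<^sup>T\<close>, which has the same trace, and
  \<open>c A + c A\<^sup>T + tr(A) I = (c + 1/2) (A + A\<^sup>T) + 1/2 ((tr(A) I - A) + (tr(A) I - A)\<^sup>T)\<close>,
  where both summands are positive semidefinite as soon as \<open>c \<ge> - 1/2\<close>.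

  The other fact is that Kronecker products of positive semidefinite matrices are positive
  semidefinite (lemma \<open>psd_kron\<close>). Repeated Schur complements write a positive semidefinite matrix as
  a sum of rank-one matrices \<open>u u\<^sup>*\<close>, which is stated as an induction rule (\<open>psd_induct\<close>); for
  \<open>A = u u\<^sup>*\<close>, the quadratic form of \<open>A \<otimes> B\<close> at \<open>w\<close> is that of \<open>B\<close> at the contraction of \<open>w\<close>
  with \<open>u\<close>.
\<close>

section \<open>Sesquilinear forms and the cone of positive semidefinite matrices\<close>

definition sform :: "complex^'n^'n \<Rightarrow> complex^'n \<Rightarrow> complex^'n \<Rightarrow> complex" where
  "sform A x y = (\<Sum>i\<in>UNIV. \<Sum>j\<in>UNIV. cnj (x $ i) * A $ i $ j * y $ j)"

lemma psd_iff_sform: "psd A \<longleftrightarrow> hermitian A \<and> (\<forall>v. 0 \<le> Re (sform A v v))"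
  by (simp add: psd_def sform_def matrix_vector_mult_def sum_distrib_left mult.assoc)

lemma sform_add_left: "sform A (x + x') y = sform A x y + sform A x' y"
  by (simp add: sform_def algebra_simps sum.distrib)

lemma sform_add_right: "sform A x (y + y') = sform A x y + sform A x y'"
  by (simp add: sform_def algebra_simps sum.distrib)

lemma sform_add_matrix: "sform (A + B) x y = sform A x y + sform B x y"
  by (simp add: sform_def algebra_simps sum.distrib)

lemma sform_diff_matrix: "sform (A - B) x y = sform A x y - sform B x y"
  by (simp add: sform_def algebra_simps sum_subtractf)

lemma sform_scaleR_matrix: "sform (r *\<^sub>R A) x y = r *\<^sub>R sform A x y"
  by (simp add: sform_def scaleR_sum_right)

lemma sum_mult_axis: "(\<Sum>i\<in>UNIV. f i * axis a (c::complex) $ i) = f a * c"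
proof -
  have "(\<Sum>i\<in>UNIV. f i * axis a c $ i) = (\<Sum>i\<in>UNIV. if a = i then f i * c else 0)"
    by (intro sum.cong) (auto simp: axis_def)
  then show ?thesis by simp
qed

lemma sform_axis_right: "sform A x (axis b c) = (\<Sum>i\<in>UNIV. cnj (x $ i) * A $ i $ b) * c"
  by (simp add: sform_def sum_mult_axis sum_distrib_right)

lemma sform_axis_left: "sform A (axis a c) y = cnj c * (\<Sum>j\<in>UNIV. A $ a $ j * y $ j)"
proof -
  have "cnj (axis a c $ i) = axis a (cnj c) $ i" for i
    by (simp add: axis_def)
  then have "sform A (axis a c) y = (\<Sum>i\<in>UNIV. (\<Sum>j\<in>UNIV. A $ i $ j * y $ j) * axis a (cnj c) $ i)"
    by (simp add: sform_def sum_distrib_left mult_ac)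
  then show ?thesis by (simp only: sum_mult_axis) (rule mult.commute)
qed

lemma sform_axis_axis: "sform A (axis a c) (axis b e) = cnj c * A $ a $ b * e"
  by (simp add: sform_axis_left sum_mult_axis mult.assoc)

lemma hermitian_cnj: "hermitian A \<Longrightarrow> cnj (A $ i $ j) = A $ j $ i"
  by (metis hermitian_def)

lemma hermitianI: "(\<And>i j. cnj (A $ i $ j) = A $ j $ i) \<Longrightarrow> hermitian A"
  by (metis hermitian_def)

lemma psd_hermitian: "psd A \<Longrightarrow> hermitian A"
  by (simp add: psd_def)

lemma psd_sform_nonneg: "psd A \<Longrightarrow> 0 \<le> Re (sform A v v)"
  by (simp add: psd_iff_sform)

lemma psd_zero: "psd 0"
  by (simp add: psd_iff_sform hermitian_def sform_def)

lemma psd_add: "psd A \<Longrightarrow> psd B \<Longrightarrow> psd (A + B)"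
  by (auto simp: psd_iff_sform sform_add_matrix hermitian_cnj intro!: hermitianI)

lemma psd_scaleR: "psd A \<Longrightarrow> 0 \<le> r \<Longrightarrow> psd (r *\<^sub>R A)"
  by (auto simp: psd_iff_sform sform_scaleR_matrix hermitian_cnj intro!: hermitianI)

lemma psd_sum: "(\<And>i. i \<in> S \<Longrightarrow> psd (f i)) \<Longrightarrow> psd (sum f S)"
  by (induction S rule: infinite_finite_induct) (auto intro: psd_zero psd_add)

lemma psd_transpose:
  assumes "psd A" shows "psd (transpose A)"
proof -
  have "sform (transpose A) v v = sform A (\<chi> i. cnj (v $ i)) (\<chi> i. cnj (v $ i))" for v
    unfolding sform_def transpose_def
    by (subst sum.swap) (simp add: mult_ac)
  moreover have "hermitian (transpose A)"
    using hermitian_cnj[OF psd_hermitian[OF assms]] by (intro hermitianI) (simp add: transpose_def)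
  ultimately show ?thesis using assms by (simp add: psd_iff_sform)
qed

lemma psd_diagonal:
  assumes "psd A"
  shows "A $ i $ i = complex_of_real (Re (A $ i $ i))" and "0 \<le> Re (A $ i $ i)"
proof -
  show "A $ i $ i = complex_of_real (Re (A $ i $ i))"
    using hermitian_cnj[OF psd_hermitian[OF assms], of i i]
    by (simp add: complex_eq_iff)
  show "0 \<le> Re (A $ i $ i)"
    using psd_sform_nonneg[OF assms, of "axis i 1"] by (simp add: sform_axis_axis)
qed

section \<open>The trace bound\<close>

text \<open>
  Lagrange's identity behind the Cauchy-Schwarz inequality, in a form that needs no diagonalisation:
  \<open>tr(A) |v|\<^sup>2 - v\<^sup>* A v\<close> is half the sum of the values of the quadratic form of \<open>A\<close> at the vectors
  \<open>cnj v\<^sub>i e\<^sub>j - cnj v\<^sub>j e\<^sub>i\<close>.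
\<close>
lemma psd_trace_bound:
  fixes A :: "complex^'n^'n"
  assumes A: "psd A"
  shows "psd (mat (trace A) - A)"
proof -
  note herm = hermitian_cnj[OF psd_hermitian[OF A]]
  have "cnj (trace A) = trace A"
    by (simp add: trace_def herm)
  then have "hermitian (mat (trace A) - A)"
    by (intro hermitianI) (simp add: mat_def herm)
  moreover have "0 \<le> Re (sform (mat (trace A) - A) v v)" for v
  proof -
    define w where "w i j = axis j (cnj (v $ i)) + axis i (- cnj (v $ j))" for i j
    have w: "sform A (w i j) (w i j)
        = cnj (v $ i) * v $ i * A $ j $ j + cnj (v $ j) * v $ j * A $ i $ i
          - cnj (v $ i) * A $ i $ j * v $ j - cnj (v $ j) * A $ j $ i * v $ i" for i j
      by (simp add: w_def sform_add_left sform_add_right sform_axis_axis)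
    have mat: "sform (mat (trace A)) v v = (\<Sum>i\<in>UNIV. cnj (v $ i) * v $ i) * trace A"
    proof -
      have "sform (mat (trace A)) v v
          = (\<Sum>i\<in>UNIV. \<Sum>j\<in>UNIV. if i = j then cnj (v $ i) * trace A * v $ j else 0)"
        unfolding sform_def mat_def by (intro sum.cong refl) auto
      then show ?thesis by (simp add: sum_distrib_left mult_ac)
    qed
    have "(\<Sum>i\<in>UNIV. \<Sum>j\<in>UNIV. sform A (w i j) (w i j))
        = sform (mat (trace A)) v v + sform (mat (trace A)) v v - sform A v v - sform A v v"
    proof -
      have 1: "(\<Sum>i\<in>UNIV. \<Sum>j\<in>UNIV. cnj (v $ i) * v $ i * A $ j $ j) = sform (mat (trace A)) v v"
        unfolding mat unfolding trace_def sum_product ..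
      have 2: "(\<Sum>i\<in>UNIV. \<Sum>j\<in>UNIV. cnj (v $ j) * v $ j * A $ i $ i) = sform (mat (trace A)) v v"
        by (subst sum.swap) (rule 1)
      have 3: "(\<Sum>i\<in>UNIV. \<Sum>j\<in>UNIV. cnj (v $ j) * A $ j $ i * v $ i) = sform A v v"
        by (subst sum.swap) (simp add: sform_def)
      show ?thesis
        unfolding w sum.distrib sum_subtractf 1 2 3 by (simp add: sform_def)
    qed
    moreover have "0 \<le> Re (\<Sum>i\<in>UNIV. \<Sum>j\<in>UNIV. sform A (w i j) (w i j))"
      unfolding Re_sum by (intro sum_nonneg psd_sform_nonneg A)
    ultimately show ?thesis by (simp add: sform_diff_matrix)
  qed
  ultimately show ?thesis by (simp add: psd_iff_sform)
qed

lemma psd_shifted_symmetrization: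
  fixes A :: "complex^'n^'n"
  assumes A: "psd A" and c: "c \<ge> - 1/2"
  shows "psd (c *\<^sub>R A + c *\<^sub>R transpose A + mat (trace A))"
proof -
  let ?D = "mat (trace A) - A"
  have "c *\<^sub>R A + c *\<^sub>R transpose A + mat (trace A)
      = (c + 1/2) *\<^sub>R (A + transpose A) + (1/2) *\<^sub>R (?D + transpose ?D)"
    by (simp add: vec_eq_iff transpose_def mat_def) (simp add: scaleR_conv_of_real field_simps)
  also have "psd \<dots>"
    using A c by (intro psd_add psd_scaleR psd_transpose psd_trace_bound) auto
  finally show ?thesis .
qed

section \<open>Rank-one decomposition\<close>

definition outer :: "complex^'n \<Rightarrow> complex^'n^'n" where
  "outer u = (\<chi> i j. u $ i * cnj (u $ j))"

text \<open>
  The quadratic form at \<open>t e\<^sub>i + e\<^sub>j\<close> is affine in \<open>t\<close> when the \<open>i\<close>-th diagonal entry vanishes, so it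
  can stay non-negative only if its slope is zero.
\<close>
lemma psd_zero_diagonal_imp_zero_row:
  assumes A: "psd A" and i: "A $ i $ i = 0"
  shows "A $ i $ j = 0"
proof (rule ccontr)
  assume ne: "A $ i $ j \<noteq> 0"
  define N where "N = (cmod (A $ i $ j))\<^sup>2"
  have N: "N > 0" using ne by (simp add: N_def)
  \<comment> \<open>This \<open>s\<close> makes the form equal to \<open>- A\<^sub>j\<^sub>j - 2\<close>.\<close>
  define s where "s = (Re (A $ j $ j) + 1) / N"
  have herm: "A $ j $ i = cnj (A $ i $ j)"
    using hermitian_cnj[OF psd_hermitian[OF A]] by simp
  have sq: "cnj (A $ i $ j) * A $ i $ j = of_real N"
    unfolding N_def complex_norm_square by (simp add: mult.commute)
  let ?v = "axis i (- of_real s * A $ i $ j) + axis j 1"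
  have "sform A ?v ?v = A $ j $ j - 2 * of_real s * (cnj (A $ i $ j) * A $ i $ j)"
    by (simp add: sform_add_left sform_add_right sform_axis_axis i herm algebra_simps)
  also have "Re \<dots> = Re (A $ j $ j) - 2 * s * N"
    unfolding sq by simp
  also have "\<dots> = - Re (A $ j $ j) - 2"
    using N by (simp add: s_def field_simps)
  finally show False
    using psd_sform_nonneg[OF A, of ?v] psd_diagonal(2)[OF A, of j] by simp
qed

text \<open>
  One step of symmetric elimination. Subtracting \<open>u u\<^sup>*\<close>, where \<open>u\<close> is the normalised \<open>a\<close>-th column,
  clears the \<open>a\<close>-th row and column; what is left is the Schur complement. Its quadratic form at \<open>v\<close>
  is the value of the form of \<open>A\<close> at the point of the line \<open>v + b e\<^sub>a\<close> where that form is
  smallest.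
\<close>
lemma psd_schur_complement:
  fixes A :: "complex^'n^'n"
  assumes A: "psd A" and a: "A $ a $ a \<noteq> 0"
  obtains u A' where "A = A' + outer u" "psd A'" "A' $ a $ a = 0"
    "\<And>i. A $ i $ i = 0 \<Longrightarrow> A' $ i $ i = 0"
proof -
  note herm = hermitian_cnj[OF psd_hermitian[OF A]]
  define r where "r = Re (A $ a $ a)"
  have Ar: "A $ a $ a = of_real r" using psd_diagonal(1)[OF A] by (simp add: r_def)
  have r: "r > 0"
    using psd_diagonal(2)[OF A, of a] a Ar by (simp add: less_le flip: r_def)
  define u where "u = (\<chi> i. A $ i $ a / of_real (sqrt r))"
  define A' where "A' = A - outer u"
  have sq: "complex_of_real (sqrt r) * of_real (sqrt r) = of_real r"
    using r by (simp flip: of_real_mult)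
  have u: "outer u $ i $ j = A $ i $ a * A $ a $ j / of_real r" for i j
    by (simp add: outer_def u_def herm sq)
  have "hermitian A'"
    by (intro hermitianI) (simp add: A'_def u herm mult.commute)
  moreover have "0 \<le> Re (sform A' v v)" for v
  proof -
    define s where "s = (\<Sum>j\<in>UNIV. A $ a $ j * v $ j)"
    have cs: "(\<Sum>i\<in>UNIV. cnj (v $ i) * A $ i $ a) = cnj s"
      by (simp add: s_def herm mult.commute)
    define w where "w = v + axis a (- s / of_real r)"
    have "sform A w w = sform A v v - cnj s * s / of_real r"
      unfolding w_def sform_add_left sform_add_right sform_axis_axis
      unfolding sform_axis_left sform_axis_right cs s_def[symmetric] Ar
      using r by (simp add: field_simps)
    also have "cnj s * s / of_real r = sform (outer u) v v"
      unfolding sform_def u cs[symmetric] unfolding s_def sum_product sum_divide_distrib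
      by (intro sum.cong refl) (simp add: mult_ac)
    also have "sform A v v - sform (outer u) v v = sform A' v v"
      by (simp add: A'_def sform_diff_matrix)
    finally show ?thesis using psd_sform_nonneg[OF A, of w] by simp
  qed
  ultimately have "psd A'" by (simp add: psd_iff_sform)
  moreover have "A' $ a $ a = 0"
    using r by (simp add: A'_def u Ar)
  moreover have "A' $ i $ i = 0" if "A $ i $ i = 0" for i
    using psd_zero_diagonal_imp_zero_row[OF A that] that by (simp add: A'_def u)
  ultimately show ?thesis using that[of A' u] by (simp add: A'_def)
qed

text \<open>
  Every positive semidefinite matrix is a sum of matrices \<open>u u\<^sup>*\<close>: each Schur complement has fewer
  non-zero diagonal entries, and a positive semidefinite matrix with zero diagonal is zero.
\<close>
lemma psd_induct [consumes 1, case_names zero add_outer]: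
  fixes A :: "complex^'n^'n"
  assumes "psd A" and zero: "P 0" and step: "\<And>A u. psd A \<Longrightarrow> P A \<Longrightarrow> P (A + outer u)"
  shows "P A"
  using assms(1)
proof (induction "card {i. A $ i $ i \<noteq> 0}" arbitrary: A rule: less_induct)
  case less
  show ?case
  proof (cases "\<exists>a. A $ a $ a \<noteq> 0")
    case False
    then have "A = 0"
      using psd_zero_diagonal_imp_zero_row[OF less.prems] by (simp add: vec_eq_iff)
    then show ?thesis using zero by simp
  next
    case True
    then obtain a where a: "A $ a $ a \<noteq> 0" by blast
    obtain u A' where A': "A = A' + outer u" "psd A'" "A' $ a $ a = 0"
      "\<And>i. A $ i $ i = 0 \<Longrightarrow> A' $ i $ i = 0"
      using psd_schur_complement[OF less.prems a] by blast
    have "{i. A' $ i $ i \<noteq> 0} \<subset> {i. A $ i $ i \<noteq> 0}"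
      using A'(3,4) a by blast
    then have "P A'"
      using A'(2) by (intro less.hyps psubset_card_mono) simp_all
    then show ?thesis unfolding A'(1) by (rule step[OF A'(2)])
  qed
qed

section \<open>Kronecker products\<close>

lemma kron_add_left: "kron (A + A') B = kron A B + kron A' B"
  by (simp add: kron_def vec_eq_iff algebra_simps)

lemma kron_add_right: "kron A (B + B') = kron A B + kron A B'"
  by (simp add: kron_def vec_eq_iff algebra_simps)

lemma kron_scaleR_left: "kron (r *\<^sub>R A) B = r *\<^sub>R kron A B"
  by (simp add: kron_def vec_eq_iff)

lemma kron_scaleR_right: "kron A (r *\<^sub>R B) = r *\<^sub>R kron A B"
  by (simp add: kron_def vec_eq_iff)

lemma kron_mat_1_cscale: "kron (mat 1) (cscale z B) = kron (mat z) B"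
  by (simp add: kron_def vec_eq_iff cscale_def mat_def)

lemma kron_cscale_mat_1: "kron (cscale z A) (mat 1) = kron A (mat z)"
  by (simp add: kron_def vec_eq_iff cscale_def mat_def)

lemma sum_UNIV_prod: "(\<Sum>p\<in>UNIV. f p) = (\<Sum>i\<in>UNIV. \<Sum>k\<in>UNIV. f (i, k))"
  by (simp add: sum.cartesian_product flip: UNIV_Times_UNIV)

lemma psd_kron_outer:
  fixes u :: "complex^'a" and B :: "complex^'b^'b"
  assumes B: "psd B"
  shows "psd (kron (outer u) B)"
proof -
  have "hermitian (kron (outer u) B)"
    using hermitian_cnj[OF psd_hermitian[OF B]]
    by (intro hermitianI) (simp add: kron_def outer_def)
  moreover have "0 \<le> Re (sform (kron (outer u) B) w w)" for w
  proof -
    \<comment> \<open>The contraction of \<open>w\<close> with \<open>u\<close> in the first factor.\<close>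
    define y where "y = (\<chi> l. \<Sum>j\<in>UNIV. cnj (u $ j) * w $ (j, l))"
    have "sform (kron (outer u) B) w w
        = (\<Sum>i\<in>UNIV. \<Sum>k\<in>UNIV. \<Sum>j\<in>UNIV. \<Sum>l\<in>UNIV.
            cnj (w $ (i, k)) * (u $ i * cnj (u $ j) * B $ k $ l) * w $ (j, l))"
      by (simp add: sform_def kron_def outer_def sum_UNIV_prod)
    also have "\<dots> = (\<Sum>k\<in>UNIV. \<Sum>i\<in>UNIV. \<Sum>l\<in>UNIV. \<Sum>j\<in>UNIV.
            cnj (w $ (i, k)) * (u $ i * cnj (u $ j) * B $ k $ l) * w $ (j, l))"
      by (subst sum.swap, intro sum.cong refl, rule sum.swap)
    also have "\<dots> = (\<Sum>k\<in>UNIV. \<Sum>l\<in>UNIV. \<Sum>i\<in>UNIV. \<Sum>j\<in>UNIV.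
            cnj (w $ (i, k)) * (u $ i * cnj (u $ j) * B $ k $ l) * w $ (j, l))"
      by (intro sum.cong refl, rule sum.swap)
    also have "\<dots> = sform B y y"
      unfolding sform_def y_def
      by (simp add: sum_distrib_left sum_distrib_right mult_ac)
    finally show ?thesis using psd_sform_nonneg[OF B] by simp
  qed
  ultimately show ?thesis by (simp add: psd_iff_sform)
qed

lemma psd_kron:
  fixes A :: "complex^'a^'a"
  assumes "psd A" and B: "psd B"
  shows "psd (kron A B)"
  using assms(1)
proof (induction A rule: psd_induct)
  case zero
  have "kron (0 :: complex^'a^'a) B = 0" by (simp add: kron_def vec_eq_iff)
  then show ?case by (simp add: psd_zero)
next
  case (add_outer A u)
  then show ?case by (simp add: kron_add_left psd_add psd_kron_outer[OF B])
qed

section \<open>Separable matrices\<close>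

lemma linear_cscale_sum:
  assumes "Vector_Spaces.linear cscale cscale f"
  shows "f (\<Sum>i\<in>S. g i) = (\<Sum>i\<in>S. f (g i))"
proof -
  have add: "f (A + B) = f A + f B" for A B
    using assms by (simp add: linear_cscale_iff)
  moreover have "f 0 = 0" using add[of 0 0] by simp
  ultimately show ?thesis
    by (induction S rule: infinite_finite_induct) simp_all
qed

lemma kron_sum_left: "kron (\<Sum>i\<in>S. f i) B = (\<Sum>i\<in>S. kron (f i) B)"
  by (simp add: kron_def vec_eq_iff sum_distrib_right)

lemma kron_sum_right: "kron A (\<Sum>i\<in>S. f i) = (\<Sum>i\<in>S. kron A (f i))"
  by (simp add: kron_def vec_eq_iff sum_distrib_left)

theorem theorem4p15:
  fixes X :: "complex^('d::finite \<times> 'd)^('d \<times> 'd)"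
  assumes "psd X" and "separable X"
  shows "\<forall>c::real. c \<ge> - 1/2 \<longrightarrow>
      psd (c *\<^sub>R X + c *\<^sub>R tensor_map transpose id X + kron (mat 1 :: complex^'d^'d) (tr1 X)) \<and>
      psd (c *\<^sub>R X + c *\<^sub>R tensor_map id transpose X + kron (tr2 X) (mat 1 :: complex^'d^'d))"
proof (intro allI impI)
  fix c :: real
  assume c: "c \<ge> - 1/2"
  obtain n :: nat and A B :: "nat \<Rightarrow> complex^'d^'d"
    where AB: "\<And>i. i < n \<Longrightarrow> psd (A i)" "\<And>i. i < n \<Longrightarrow> psd (B i)"
      and X: "X = (\<Sum>i<n. kron (A i) (B i))"
    using assms(2) unfolding separable_def by blast
  note expand = X linear_cscale_sum[OF linear_tensor_map] linear_cscale_sum[OF linear_tr1]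
    linear_cscale_sum[OF linear_tr2] tensor_map_kron[OF linear_transpose linear_ident]
    tensor_map_kron[OF linear_ident linear_transpose] tr1_kron tr2_kron
    kron_sum_left kron_sum_right kron_mat_1_cscale kron_cscale_mat_1
    kron_add_left kron_add_right kron_scaleR_left kron_scaleR_right
    scaleR_sum_right sum.distrib
  have "c *\<^sub>R X + c *\<^sub>R tensor_map transpose id X + kron (mat 1 :: complex^'d^'d) (tr1 X)
      = (\<Sum>i<n. kron (c *\<^sub>R A i + c *\<^sub>R transpose (A i) + mat (trace (A i))) (B i))"
    by (simp add: expand)
  moreover have "c *\<^sub>R X + c *\<^sub>R tensor_map id transpose X + kron (tr2 X) (mat 1 :: complex^'d^'d)
      = (\<Sum>i<n. kron (A i) (c *\<^sub>R B i + c *\<^sub>R transpose (B i) + mat (trace (B i))))"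
    by (simp add: expand)
  ultimately show
    "psd (c *\<^sub>R X + c *\<^sub>R tensor_map transpose id X + kron (mat 1 :: complex^'d^'d) (tr1 X)) \<and>
     psd (c *\<^sub>R X + c *\<^sub>R tensor_map id transpose X + kron (tr2 X) (mat 1 :: complex^'d^'d))"
    using AB c by (auto intro!: psd_sum psd_kron psd_shifted_symmetrization)
qed

end
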